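(* Let $\alpha,\beta,\gamma>0$, let $\phi$ and $V_\phi$ be as described in the context, let $\rho>0$ be such that $Z_{\alpha,\beta,\gamma}(\rho,\phi)=\sum_{k=0}^\infty\frac{\Gamma(k+\gamma)\,\rho^k}{k!\,V_\phi(\alpha k+\beta)}$ converges, and let $X$ be the random variable with values in $\mathbb{N}=\{0,1,2,\dots\}$ and probability mass function $$\mathbb{P}(X=n)=\frac{\Gamma(n+\gamma)\,\rho^n}{n!\,V_\phi(\alpha n+\beta)}\,\frac{1}{Z_{\alpha,\beta,\gamma}(\rho,\phi)},\qquad n\in\mathbb{N}.$$ Let $\psi_\phi(y)=\frac{\mathrm{d}}{\mathrm{d}y}\log V_\phi(y)$, $y>0$, let $\psi_{\mathrm{id}}(y)=\frac{\mathrm{d}}{\mathrm{d}y}\log\Gamma(y)$ be the classical digamma function, and let $\psi_\phi'$, $\psi_{\mathrm{id}}'$ be their first derivatives. If $$\psi_{\mathrm{id}}'(y+\gamma)\ \ge\ (\le)\ \alpha\,\psi_\phi'(\alpha y+\beta)\qquad\text{for all } y>0,$$ then $X$ is overdispersed (underdispersed).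
   Context: The function $\phi:(0,\infty)\to(0,\infty)$ and the associated function $V_\phi$ on $(0,\infty)$ are of one of the following two types. (1) $\phi$ is a Bernstein function, i.e. $\phi\in\mathcal{C}^\infty$, $\phi\ge0$, and $(-1)^{n-1}\phi^{(n)}\ge0$ on $(0,\infty)$ for all integers $n\ge1$, and $V_\phi=W_\phi$ is the Bernstein-gamma function of $\phi$, i.e. the unique solution, in the space of positive definite functions, of the functional equation $W_\phi(x+1)=\phi(x)W_\phi(x)$ with $W_\phi(1)=1$ (considered for real $x>0$). (2) $\phi$ is eventually log-convex (there is $m\in\mathbb{R}$ such that $\log\phi$ is convex on the part of $(m,\infty)$ contained in $(0,\infty)$) with $\lim_{n\to\infty}\phi(n)/\phi(n+1)=1$, and $V_\phi=\widetilde W_\phi$ with $\widetilde W_\phi(x)=\lim_{n\to\infty}\frac{\phi(n)\cdots\phi(1)\,(\phi(n))^x}{\phi(n+x)\phi(n-1+x)\cdots\phi(x)}$ for $x>0$; this satisfies $\widetilde W_\phi(1)=1$ and $\widetilde W_\phi(x+1)=\phi(x)\widetilde W_\phi(x)$. A random variable is called overdispersed if its variance-to-mean ratio is greater than $1$, and underdispersed if its variance-to-mean ratio is less than $1$.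
   Formalization: The right side is α²ψ_φ'(αy+β) (α times d/dy of ψ_φ(αy+β)); with a single α the claim fails (V=Γ, α=2, β=2γ). Equality for all y>0 (Poisson X, ratio 1) is excluded, and overdispersion assumes X has finite mean, as otherwise the ratio is undefined. *)

theory Defs
  imports "HOL-Probability.Probability"
begin

text \<open>Functions on \<open>(0,\<infinity>)\<close> are total functions on the reals of which only the values at positive
  arguments are used.\<close>

definition bernstein_function :: "(real \<Rightarrow> real) \<Rightarrow> bool" where
  "bernstein_function \<phi> \<longleftrightarrow>
     (\<forall>n. \<forall>x>0. ((deriv ^^ n) \<phi>) differentiable at x) \<and>
     (\<forall>x>0. 0 \<le> \<phi> x) \<and>
     (\<forall>n\<ge>1. \<forall>x>0. 0 \<le> (-1) ^ (n - 1) * (deriv ^^ n) \<phi> x)"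

text \<open>Continuous positive definite functions on the additive semigroup \<open>(0,\<infinity>)\<close> (with the identity
  as involution). Continuity is part of the notion, as in Bochner's theorem; without it, the
  characterisation of the Bernstein-gamma function below would not be unique (multiply a solution
  by the exponential of a discontinuous additive function that vanishes at 1).\<close>

definition positive_definite :: "(real \<Rightarrow> real) \<Rightarrow> bool" where
  "positive_definite W \<longleftrightarrow>
     continuous_on {0<..} W \<and>
     (\<forall>n (x :: nat \<Rightarrow> real) (c :: nat \<Rightarrow> real). (\<forall>i<n. 0 < x i) \<longrightarrow>
        0 \<le> (\<Sum>i<n. \<Sum>j<n. c i * c j * W (x i + x j)))"

definition is_bernstein_gamma :: "(real \<Rightarrow> real) \<Rightarrow> (real \<Rightarrow> real) \<Rightarrow> bool" where
  "is_bernstein_gamma \<phi> W \<longleftrightarrow>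
     positive_definite W \<and> W 1 = 1 \<and> (\<forall>x>0. W (x + 1) = \<phi> x * W x)"

definition eventually_log_convex :: "(real \<Rightarrow> real) \<Rightarrow> bool" where
  "eventually_log_convex \<phi> \<longleftrightarrow> (\<exists>m. convex_on ({m<..} \<inter> {0<..}) (\<lambda>x. ln (\<phi> x)))"

definition is_limit_gamma :: "(real \<Rightarrow> real) \<Rightarrow> (real \<Rightarrow> real) \<Rightarrow> bool" where
  "is_limit_gamma \<phi> W \<longleftrightarrow>
     (\<forall>x>0. (\<lambda>n. (\<Prod>k=1..n. \<phi> (real k)) * \<phi> (real n) powr x / (\<Prod>k=0..n. \<phi> (real k + x)))
              \<longlonglongrightarrow> W x)"

text \<open>For \<open>f y = ln (Gamma (y + \<gamma>)) - ln (V (\<alpha> * y + \<beta>))\<close>, the inequality between digamma derivatives is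
  convexity or concavity of \<open>f\<close>. Its right-hand side is therefore \<open>\<alpha>\<close> times the derivative in \<open>y\<close> of
  \<open>psi V (\<alpha> * y + \<beta>)\<close>, that is, \<open>\<alpha>\<^sup>2\<close> times \<open>deriv (psi V)\<close> at \<open>\<alpha> * y + \<beta>\<close>.
  With a single factor \<open>\<alpha>\<close> in the latter form, \<open>V = Gamma\<close>, \<open>\<alpha> = 2\<close>, \<open>\<beta> = 2 * \<gamma>\<close> would satisfy the
  condition for overdispersion although the distribution is underdispersed.\<close>

definition psi :: "(real \<Rightarrow> real) \<Rightarrow> real \<Rightarrow> real" where
  "psi V y = deriv (\<lambda>t. ln (V t)) y"

text \<open>An eventually log-convex function need not be smooth, so for the second type the existence of
  the derivatives \<open>\<psi>\<^sub>\<phi>\<close> and \<open>\<psi>\<^sub>\<phi>'\<close> is a requirement. For the first type they exist automatically.\<close>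

definition admissible :: "(real \<Rightarrow> real) \<Rightarrow> (real \<Rightarrow> real) \<Rightarrow> bool" where
  "admissible \<phi> V \<longleftrightarrow>
     (\<forall>x>0. 0 < \<phi> x) \<and>
     (bernstein_function \<phi> \<and> is_bernstein_gamma \<phi> V \<or>
      eventually_log_convex \<phi> \<and> (\<lambda>n. \<phi> (real n) / \<phi> (real (n + 1))) \<longlonglongrightarrow> 1 \<and> is_limit_gamma \<phi> V \<and>
        (\<forall>y>0. (\<lambda>t. ln (V t)) differentiable at y \<and> psi V differentiable at y))"

definition weight_term :: "real \<Rightarrow> real \<Rightarrow> real \<Rightarrow> (real \<Rightarrow> real) \<Rightarrow> real \<Rightarrow> nat \<Rightarrow> real" where
  "weight_term \<alpha> \<beta> \<gamma> V \<rho> k = Gamma (real k + \<gamma>) * \<rho> ^ k / (fact k * V (\<alpha> * real k + \<beta>))"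

definition Z :: "real \<Rightarrow> real \<Rightarrow> real \<Rightarrow> (real \<Rightarrow> real) \<Rightarrow> real \<Rightarrow> real" where
  "Z \<alpha> \<beta> \<gamma> V \<rho> = (\<Sum>k. weight_term \<alpha> \<beta> \<gamma> V \<rho> k)"

text \<open>The variance is taken in \<open>[0,\<infinity>]\<close>, so that a variable with finite mean and infinite variance
  has ratio \<open>\<infinity>\<close>; the Bochner integral would give it variance 0. The ratio is meaningful
  only for a variable with finite mean, whence the integrability in the two notions below.\<close>

definition variance_to_mean :: "'a measure \<Rightarrow> ('a \<Rightarrow> real) \<Rightarrow> ennreal" where
  "variance_to_mean M X =
     (\<integral>\<^sup>+ \<omega>. ennreal ((X \<omega> - integral\<^sup>L M X)\<^sup>2) \<partial>M) / ennreal (integral\<^sup>L M X)"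

definition overdispersed :: "'a measure \<Rightarrow> ('a \<Rightarrow> real) \<Rightarrow> bool" where
  "overdispersed M X \<longleftrightarrow> integrable M X \<and> 1 < variance_to_mean M X"

definition underdispersed :: "'a measure \<Rightarrow> ('a \<Rightarrow> real) \<Rightarrow> bool" where
  "underdispersed M X \<longleftrightarrow> integrable M X \<and> variance_to_mean M X < 1"

lemma (in prob_space) variance_to_mean_eq:
  assumes "integrable M X" "integrable M (\<lambda>\<omega>. (X \<omega>)\<^sup>2)" "0 < expectation X"
  shows "variance_to_mean M X = ennreal (variance X / expectation X)"
proof -
  have "integrable M (\<lambda>\<omega>. (X \<omega> - expectation X)\<^sup>2)"
    using assms by (simp add: power2_diff)
  then have "(\<integral>\<^sup>+ \<omega>. ennreal ((X \<omega> - expectation X)\<^sup>2) \<partial>M) = ennreal (variance X)"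
    by (simp add: nn_integral_eq_integral)
  then show ?thesis
    using assms(3) by (simp add: variance_to_mean_def divide_ennreal)
qed

end

theory Submission
  imports Defs
begin

text \<open>
  Put \<open>f y = ln \<Gamma>(y + \<gamma>) - ln V(\<alpha> y + \<beta>)\<close>, so that \<open>p k = P(X = k)\<close> is proportional to
  \<open>exp (f k) \<rho>\<^sup>k / k!\<close>. Then \<open>(k + 1) p (k + 1) = r k * p k\<close> with \<open>r k = \<rho> exp (f (k + 1) - f k)\<close>. An index
  shift in the moment sums turns this into \<open>E X = E (r X)\<close> and \<open>E (X (X - 1)) = E (X r X)\<close>, whence
  \<open>Var X - E X = Cov (X, r X)\<close>. The comparison of the digamma derivatives says that \<open>f'' \<ge> 0\<close> (or \<open>\<le> 0\<close>), which
  makes \<open>r\<close> increasing (or decreasing), and Chebyshev's correlation inequality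
  (\<open>strict_chebyshev_correlation\<close>) gives the sign of the covariance. It is strict unless \<open>r\<close> is constant;
  but then \<open>f\<close> is affine on \<open>\<nat>\<close>, by convexity affine on \<open>[0,\<infinity>)\<close>, and \<open>f''\<close> vanishes identically
  (\<open>mono_increments_of_second_derivative\<close>). In the decreasing case \<open>r\<close> is bounded and all moments involved
  are finite; in the increasing case the second moment may be infinite, and so is then the variance.

  The analytic input is that \<open>V\<close> is positive and that \<open>ln V\<close> is twice differentiable
  (\<open>admissible_regular\<close>). For the Bernstein-gamma function \<open>W\<close> of \<open>\<phi>\<close> this has to be extracted from positive
  definiteness. The Cauchy-Schwarz inequality for positive definite functions makes \<open>W\<close> positive and
  \<open>ln W\<close> midpoint convex, hence convex. As in the Bohr-Mollerup theorem, convexity and the functional equation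
  determine \<open>ln W\<close> (\<open>bohr_mollerup_limit\<close>): it is a series in \<open>L = ln \<phi>\<close> like the Weierstrass expansion of
  \<open>ln \<Gamma>\<close>, and since \<open>L'' x = O(1 / x\<^sup>2)\<close> for a Bernstein function, the series may be differentiated twice.
  For the second type the derivatives exist by definition, and the positivity of the limit follows from
  a lower bound that convexity of \<open>ln \<phi>\<close> provides (\<open>limit_gamma_pos\<close>).
\<close>

section \<open>Dispersion and the ratio of consecutive probabilities\<close>

text \<open>
  Chebyshev's correlation inequality for a fully supported law on \<open>\<nat>\<close>: \<open>k\<close> and an increasing \<open>r k\<close> are
  positively correlated. A nonconstant \<open>r\<close> must exceed its mean \<open>m\<close> somewhere, and from the first such
  index on it always does, which makes the inequality strict.
\<close>
lemma strict_chebyshev_correlation: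
  fixes p r :: "nat \<Rightarrow> real"
  assumes pos: "\<And>k. 0 < p k" and p1: "p sums 1"
    and mono: "mono r" and nonconst: "r i \<noteq> r j"
    and e: "(\<lambda>k. real k * p k) sums e" and m: "(\<lambda>k. r k * p k) sums m"
    and c: "(\<lambda>k. real k * (r k * p k)) sums c"
  shows "e * m < c"
proof -
  have "\<exists>l. m < r l"
  proof (rule ccontr)
    assume "\<not> (\<exists>l. m < r l)"
    then have le: "r l \<le> m" for l by (simp add: not_less)
    have s: "(\<lambda>k. m * p k - r k * p k) sums (m * 1 - m)"
      by (intro sums_diff sums_mult p1 m)
    have nn: "0 \<le> m * p k - r k * p k" for k
      using mult_right_mono[OF le[of k], of "p k"] pos[of k] by simp
    have "\<forall>k. m * p k - r k * p k = 0"
      using suminf_eq_zero_iff[OF sums_summable[OF s] nn] sums_unique[OF s] by simp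
    then have "r k = m" for k
      using pos[of k] by (metis eq_iff_diff_eq_0 less_irrefl mult_cancel_right)
    with nonconst show False by simp
  qed
  define K where "K = (LEAST l. m < r l)"
  have K: "m < r K" using LeastI_ex[OF \<open>\<exists>l. m < r l\<close>] by (simp add: K_def)
  have below: "r l \<le> m" if "l < K" for l
    using not_less_Least[of l "\<lambda>l. m < r l"] that by (simp add: K_def not_less)
  \<comment> \<open>The correlation does not change when \<open>k\<close> is shifted by a constant. The shift \<open>\<kappa>\<close> is placed strictly
    between \<open>K - 1\<close> and \<open>K\<close>, so that \<open>k - \<kappa>\<close> and \<open>r k - m\<close> change sign at the same index and every
    term of the sum is nonnegative, with a strictly positive one at \<open>K\<close>.\<close>
  define \<kappa> where "\<kappa> = real K - 1/2"
  let ?d = "\<lambda>k. real k * (r k * p k) - \<kappa> * (r k * p k) - m * (real k * p k) + \<kappa> * m * p k"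
  have d: "?d sums (c - \<kappa> * m - m * e + \<kappa> * m * 1)"
    by (intro sums_add sums_diff sums_mult p1 m e c)
  have d_eq: "?d k = (real k - \<kappa>) * (r k - m) * p k" for k
    by (simp add: algebra_simps)
  have "0 \<le> ?d k" for k
  proof (cases "k < K")
    case True
    then have "real k - \<kappa> \<le> 0" by (simp add: \<kappa>_def)
    then show ?thesis
      unfolding d_eq using below[OF True] pos[of k]
      by (intro mult_nonneg_nonneg mult_nonpos_nonpos) auto
  next
    case False
    then have "r K \<le> r k" using mono by (simp add: monoD)
    then show ?thesis
      unfolding d_eq using False K pos[of k]
      by (intro mult_nonneg_nonneg) (auto simp: \<kappa>_def)
  qed
  moreover have "0 < ?d K"
    unfolding d_eq using K pos[of K] by (simp add: \<kappa>_def)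
  ultimately have "0 < suminf ?d"
    by (intro suminf_pos2 sums_summable[OF d])
  then show ?thesis using sums_unique[OF d] by (simp add: mult.commute)
qed

text \<open>
  Shifting the index by one turns the moments of \<open>p\<close> into moments of \<open>r\<close>: with
  \<open>(k + 1) p\<^sub>k\<^sub>+\<^sub>1 = r\<^sub>k p\<^sub>k\<close> one has \<open>E X = E (r X)\<close> and \<open>E (X (X - 1)) = E (X r X)\<close>.
\<close>
lemma sums_first_moment:
  fixes p r :: "nat \<Rightarrow> real"
  assumes "\<And>k. real (Suc k) * p (Suc k) = r k * p k"
  shows "(\<lambda>k. real k * p k) sums e \<longleftrightarrow> (\<lambda>k. r k * p k) sums e"
  using sums_Suc_iff[of "\<lambda>k. real k * p k" e] assms by simp

lemma sums_second_factorial_moment: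
  fixes p r :: "nat \<Rightarrow> real"
  assumes "\<And>k. real (Suc k) * p (Suc k) = r k * p k"
  shows "(\<lambda>k. real k * (real k - 1) * p k) sums c \<longleftrightarrow> (\<lambda>k. real k * (r k * p k)) sums c"
proof -
  have "real (Suc k) * (real (Suc k) - 1) * p (Suc k) = real k * (r k * p k)" for k
    using assms[of k] by (simp add: mult.assoc)
  with sums_Suc_iff[of "\<lambda>k. real k * (real k - 1) * p k" c] show ?thesis
    by (simp del: of_nat_Suc)
qed

text \<open>
  The index shifts give \<open>Var X - E X = Cov (X, r X)\<close>, so the correlation inequality decides the sign.
  For a Poisson law \<open>r\<close> is constant and the difference is 0.
\<close>
lemma variance_gt_mean_of_mono_ratio:
  fixes p r :: "nat \<Rightarrow> real"
  assumes pos: "\<And>k. 0 < p k" and p1: "p sums 1"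
    and rec: "\<And>k. real (Suc k) * p (Suc k) = r k * p k"
    and r: "mono r" "r i \<noteq> r j"
    and e: "(\<lambda>k. real k * p k) sums e" and q: "(\<lambda>k. (real k)\<^sup>2 * p k) sums q"
  shows "e < q - e\<^sup>2"
proof -
  have "(\<lambda>k. (real k)\<^sup>2 * p k - real k * p k) sums (q - e)"
    by (intro sums_diff q e)
  then have "(\<lambda>k. real k * (real k - 1) * p k) sums (q - e)"
    by (simp add: algebra_simps power2_eq_square)
  then have "(\<lambda>k. real k * (r k * p k)) sums (q - e)"
    by (simp only: sums_second_factorial_moment[OF rec])
  moreover have "(\<lambda>k. r k * p k) sums e"
    using e by (simp only: sums_first_moment[OF rec])
  ultimately have "e * e < q - e"
    by (intro strict_chebyshev_correlation[OF pos p1 r e])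
  then show ?thesis by (simp add: power2_eq_square)
qed

lemma variance_lt_mean_of_antimono_ratio:
  fixes p r :: "nat \<Rightarrow> real"
  assumes pos: "\<And>k. 0 < p k" and p1: "p sums 1"
    and rec: "\<And>k. real (Suc k) * p (Suc k) = r k * p k"
    and r: "antimono r" "r i \<noteq> r j"
    and e: "(\<lambda>k. real k * p k) sums e" and q: "(\<lambda>k. (real k)\<^sup>2 * p k) sums q"
  shows "q - e\<^sup>2 < e"
proof -
  have "(\<lambda>k. (real k)\<^sup>2 * p k - real k * p k) sums (q - e)"
    by (intro sums_diff q e)
  then have "(\<lambda>k. real k * (real k - 1) * p k) sums (q - e)"
    by (simp add: algebra_simps power2_eq_square)
  then have "(\<lambda>k. real k * (r k * p k)) sums (q - e)"
    by (simp only: sums_second_factorial_moment[OF rec])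
  then have c: "(\<lambda>k. real k * (- r k * p k)) sums - (q - e)"
    using sums_minus by fastforce
  have "(\<lambda>k. r k * p k) sums e"
    using e by (simp only: sums_first_moment[OF rec])
  then have m: "(\<lambda>k. - r k * p k) sums - e"
    using sums_minus by fastforce
  have "mono (\<lambda>k. - r k)" using r(1) by (auto simp: monotone_def)
  then have "e * - e < - (q - e)"
    using r(2) by (intro strict_chebyshev_correlation[OF pos p1 _ _ e m c]) auto
  then show ?thesis by (simp add: power2_eq_square)
qed

text \<open>
  A decreasing \<open>r\<close> is bounded by \<open>r 0\<close>, so each index shift bounds a moment by \<open>r 0\<close> times the previous one.
\<close>
lemma summable_moments_of_antimono_ratio:
  fixes p r :: "nat \<Rightarrow> real"
  assumes pos: "\<And>k. 0 < p k" and p: "summable p"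
    and rec: "\<And>k. real (Suc k) * p (Suc k) = r k * p k"
    and r: "antimono r"
  shows "summable (\<lambda>k. real k * p k)" "summable (\<lambda>k. (real k)\<^sup>2 * p k)"
proof -
  have r0: "0 \<le> r k" for k
  proof -
    have "0 < r k * p k" unfolding rec[symmetric] using pos[of "Suc k"] by simp
    with pos[of k] show ?thesis by (simp add: zero_less_mult_iff)
  qed
  have r1: "r k \<le> r 0" for k using r by (simp add: antimonoD)
  have "summable (\<lambda>k. r k * p k)"
    by (rule summable_comparison_test'[OF summable_mult[OF p, of "r 0"], of 0])
       (use r0 r1 less_imp_le[OF pos] in \<open>auto simp: abs_mult intro!: mult_right_mono\<close>)
  then show 1: "summable (\<lambda>k. real k * p k)"
    using sums_first_moment[OF rec] by (auto simp: summable_def)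
  have "summable (\<lambda>k. real k * (r k * p k))"
    by (rule summable_comparison_test'[OF summable_mult[OF 1, of "r 0"], of 0])
       (use r0 r1 less_imp_le[OF pos] in
         \<open>auto simp: abs_mult mult.left_commute[of "r 0"] intro!: mult_left_mono mult_right_mono\<close>)
  then have "summable (\<lambda>k. real k * (real k - 1) * p k)"
    using sums_second_factorial_moment[OF rec] by (auto simp: summable_def)
  from summable_add[OF this 1] show "summable (\<lambda>k. (real k)\<^sup>2 * p k)"
    by (simp add: algebra_simps power2_eq_square)
qed

section \<open>Moments of random variables with values in the natural numbers\<close>

lemma (in prob_space) nn_integral_of_nat_valued:
  fixes X :: "'a \<Rightarrow> nat" and h :: "nat \<Rightarrow> real"
  assumes X: "X \<in> measurable M (count_space UNIV)" and h: "\<And>n. 0 \<le> h n"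
  shows "(\<integral>\<^sup>+ \<omega>. ennreal (h (X \<omega>)) \<partial>M) = (\<Sum>n. ennreal (h n * prob {\<omega> \<in> space M. X \<omega> = n}))"
proof -
  let ?A = "\<lambda>n. {\<omega> \<in> space M. X \<omega> = n}"
  have A: "?A n \<in> sets M" for n
    using measurable_sets[OF X, of "{n}"] by (simp add: vimage_def Int_def conj_commute)
  have "(\<integral>\<^sup>+ \<omega>. ennreal (h (X \<omega>)) \<partial>M) = (\<integral>\<^sup>+ \<omega>. (\<Sum>n. ennreal (h n) * indicator (?A n) \<omega>) \<partial>M)"
  proof (rule nn_integral_cong)
    fix \<omega> assume "\<omega> \<in> space M"
    then have "(\<Sum>n. ennreal (h n) * indicator (?A n) \<omega>) = (\<Sum>n\<in>{X \<omega>}. ennreal (h n) * indicator (?A n) \<omega>)"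
      by (intro suminf_finite) auto
    with \<open>\<omega> \<in> space M\<close> show "ennreal (h (X \<omega>)) = (\<Sum>n. ennreal (h n) * indicator (?A n) \<omega>)" by simp
  qed
  also have "\<dots> = (\<Sum>n. \<integral>\<^sup>+ \<omega>. ennreal (h n) * indicator (?A n) \<omega> \<partial>M)"
    using A by (intro nn_integral_suminf) auto
  also have "\<dots> = (\<Sum>n. ennreal (h n * prob (?A n)))"
    using A h by (simp add: nn_integral_cmult_indicator emeasure_eq_measure ennreal_mult')
  finally show ?thesis .
qed

lemma (in prob_space) expectation_of_nat_valued:
  fixes X :: "'a \<Rightarrow> nat" and h :: "nat \<Rightarrow> real"
  assumes X: "X \<in> measurable M (count_space UNIV)" and h: "\<And>n. 0 \<le> h n"
  shows "integrable M (\<lambda>\<omega>. h (X \<omega>)) \<longleftrightarrow> summable (\<lambda>n. h n * prob {\<omega> \<in> space M. X \<omega> = n})" (is ?I)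
    and "integrable M (\<lambda>\<omega>. h (X \<omega>)) \<Longrightarrow>
      (\<lambda>n. h n * prob {\<omega> \<in> space M. X \<omega> = n}) sums expectation (\<lambda>\<omega>. h (X \<omega>))"
proof -
  let ?s = "\<lambda>n. h n * prob {\<omega> \<in> space M. X \<omega> = n}"
  have s0: "0 \<le> ?s n" for n using h by simp
  have meas: "(\<lambda>\<omega>. h (X \<omega>)) \<in> borel_measurable M"
    using measurable_compose[OF X, of h borel] by simp
  have int: "integrable M (\<lambda>\<omega>. h (X \<omega>)) \<longleftrightarrow> (\<Sum>n. ennreal (?s n)) < \<infinity>"
    using meas h unfolding integrable_iff_bounded by (simp add: nn_integral_of_nat_valued[where h = h, OF X h])
  also have "\<dots> \<longleftrightarrow> summable ?s"
  proof
    assume "(\<Sum>n. ennreal (?s n)) < \<infinity>"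
    then have "(\<Sum>n. ennreal (?s n)) \<noteq> top" by simp
    then show "summable ?s" by (rule summable_suminf_not_top[OF s0])
  next
    assume "summable ?s"
    then have "(\<Sum>n. ennreal (?s n)) \<noteq> top" by (rule ennreal_suminf_neq_top[OF _ s0])
    then show "(\<Sum>n. ennreal (?s n)) < \<infinity>" by (simp only: infinity_ennreal_def less_top)
  qed
  finally show I: ?I .
  assume i: "integrable M (\<lambda>\<omega>. h (X \<omega>))"
  then have s: "summable ?s" using I by simp
  have "ennreal (expectation (\<lambda>\<omega>. h (X \<omega>))) = ennreal (suminf ?s)"
    using nn_integral_eq_integral[OF i] nn_integral_of_nat_valued[where h = h, OF X h] h suminf_ennreal2[OF s0 s] by simp
  then have "expectation (\<lambda>\<omega>. h (X \<omega>)) = suminf ?s"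
    using h s0 s by (simp add: suminf_nonneg)
  with s show "?s sums expectation (\<lambda>\<omega>. h (X \<omega>))" by (simp add: sums_iff)
qed

text \<open>
  With an infinite second moment the variance, taken in \<open>[0,\<infinity>]\<close>, is infinite, and the ratio exceeds 1
  for this reason alone.
\<close>
lemma (in prob_space) overdispersed_of_second_moment:
  assumes X: "integrable M X" and e: "0 < expectation X"
    and var: "integrable M (\<lambda>\<omega>. (X \<omega>)\<^sup>2) \<Longrightarrow>
      expectation X < expectation (\<lambda>\<omega>. (X \<omega>)\<^sup>2) - (expectation X)\<^sup>2"
  shows "overdispersed M X"
proof (cases "integrable M (\<lambda>\<omega>. (X \<omega>)\<^sup>2)")
  case True
  then have "1 < variance X / expectation X"
    using var variance_eq[OF X True] e by simp
  then show ?thesis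
    using X variance_to_mean_eq[OF X True e] by (simp add: overdispersed_def)
next
  case False
  have "(\<integral>\<^sup>+ \<omega>. ennreal ((X \<omega> - expectation X)\<^sup>2) \<partial>M) = \<infinity>"
  proof (rule ccontr)
    assume "\<not> ?thesis"
    then have "integrable M (\<lambda>\<omega>. (X \<omega> - expectation X)\<^sup>2)"
      using X by (intro integrableI_bounded) (auto simp: less_top)
    then have "integrable M (\<lambda>\<omega>. (X \<omega> - expectation X)\<^sup>2 + 2 * expectation X * X \<omega> - (expectation X)\<^sup>2)"
      using X by (intro Bochner_Integration.integrable_diff Bochner_Integration.integrable_add) auto
    then have "integrable M (\<lambda>\<omega>. (X \<omega>)\<^sup>2)" by (simp add: power2_diff algebra_simps)
    with False show False by simp
  qed
  then show ?thesis
    using X e by (simp add: overdispersed_def variance_to_mean_def ennreal_top_divide)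
qed

lemma (in prob_space) underdispersed_of_second_moment:
  assumes X: "integrable M X" "integrable M (\<lambda>\<omega>. (X \<omega>)\<^sup>2)" and e: "0 < expectation X"
    and var: "expectation (\<lambda>\<omega>. (X \<omega>)\<^sup>2) - (expectation X)\<^sup>2 < expectation X"
  shows "underdispersed M X"
proof -
  have "variance X / expectation X < 1"
    using var variance_eq[OF X] e by simp
  then show ?thesis
    using X(1) variance_to_mean_eq[OF X e] by (simp add: underdispersed_def ennreal_less_one_iff)
qed

section \<open>Convex functions on the real line\<close>

text \<open>
  Jensen's theorem. On a segment subtract the chord; the difference \<open>h\<close> is midpoint convex, vanishes at
  the ends and has a maximum by continuity. A positive maximum would exceed the mean of \<open>h\<close> at an end
  and at another point of the segment.
\<close>
lemma convex_on_of_midpoint_convex: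
  fixes g :: "real \<Rightarrow> real"
  assumes S: "convex S" and cont: "continuous_on S g"
    and mid: "\<And>x y. x \<in> S \<Longrightarrow> y \<in> S \<Longrightarrow> g ((x + y) / 2) \<le> (g x + g y) / 2"
  shows "convex_on S g"
proof (rule convex_onI[OF _ S])
  fix t x y :: real
  assume t: "0 < t" "t < 1" and x: "x \<in> S" and y: "y \<in> S"
  define l where "l s = (1 - s) * x + s * y" for s
  define h where "h s = g (l s) - ((1 - s) * g x + s * g y)" for s
  have l_in: "l s \<in> S" if "s \<in> {0..1}" for s
    using S x y that unfolding l_def by (auto simp: convex_alt)
  have "continuous_on {0..1} l" unfolding l_def by (intro continuous_intros)
  then have "continuous_on {0..1} h"
    unfolding h_def by (intro continuous_intros continuous_on_compose2[OF cont]) (use l_in in auto)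
  then obtain c where c: "c \<in> {0..1}" and max: "\<And>s. s \<in> {0..1} \<Longrightarrow> h s \<le> h c"
    using continuous_attains_sup[of "{0..1::real}" h] by (metis compact_Icc atLeastAtMost_iff empty_iff order_refl zero_le_one)
  have ends: "h 0 = 0" "h 1 = 0" by (simp_all add: h_def l_def)
  have hmid: "h ((s + s') / 2) \<le> (h s + h s') / 2" if "s \<in> {0..1}" "s' \<in> {0..1}" for s s'
  proof -
    have "l ((s + s') / 2) = (l s + l s') / 2" by (simp add: l_def field_simps)
    then have "g (l ((s + s') / 2)) \<le> (g (l s) + g (l s')) / 2"
      using mid[OF l_in l_in, OF that] by (simp only:)
    then show ?thesis by (simp add: h_def field_simps)
  qed
  \<comment> \<open>The maximum point \<open>c\<close> is the midpoint of the nearer end, where \<open>h\<close> vanishes, and its mirror image.\<close>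
  have "h c \<le> 0"
  proof (cases "c \<le> 1/2")
    case True
    with c have "h ((0 + 2 * c) / 2) \<le> (h 0 + h (2 * c)) / 2" by (intro hmid) auto
    moreover have "h (2 * c) \<le> h c" using True c by (intro max) auto
    ultimately show ?thesis using ends by simp
  next
    case False
    with c have "h ((1 + (2 * c - 1)) / 2) \<le> (h 1 + h (2 * c - 1)) / 2" by (intro hmid) auto
    moreover have "h (2 * c - 1) \<le> h c" using False c by (intro max) auto
    ultimately show ?thesis using ends by simp
  qed
  with max[of t] t have "h t \<le> 0" by auto
  then show "g ((1 - t) *\<^sub>R x + t *\<^sub>R y) \<le> (1 - t) * g x + t * g y"
    by (simp add: h_def l_def)
qed

lemma convex_on_slopes_increase:
  fixes f :: "real \<Rightarrow> real"
  assumes conv: "convex_on I f" and I: "a \<in> I" "d \<in> I" and "a < b" "b \<le> c" "c < d"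
  shows "(f b - f a) / (b - a) \<le> (f d - f c) / (d - c)"
proof -
  have I_interval: "is_interval I" using convex_on_imp_convex[OF conv] by (simp add: is_interval_convex_1)
  have "b \<in> I" "c \<in> I"
    by (rule mem_is_interval_1_I[OF I_interval I]; use assms in simp)+
  have "(f a - f b) / (a - b) \<le> (f b - f d) / (b - d)"
    using convex_on_slope_le[OF conv I, of b] assms by linarith
  also have "\<dots> \<le> (f c - f d) / (c - d)"
    using convex_on_slope_le(2)[OF conv \<open>b \<in> I\<close> \<open>d \<in> I\<close>, of c] assms by (cases "b = c") auto
  finally show ?thesis using minus_divide_divide[of "f b - f a" "b - a"] minus_divide_divide[of "f d - f c" "d - c"] by simp
qed

text \<open>
  After subtracting the affine function, a point \<open>x\<close> lies between the zeros 0 and \<open>k\<close>, which gives \<open>g x \<le> 0\<close>,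
  and to the left of the two zeros \<open>k\<close> and \<open>k + 1\<close>, which gives \<open>g x \<ge> 0\<close>.
\<close>
lemma affine_if_convex_and_affine_on_nat:
  fixes f :: "real \<Rightarrow> real"
  assumes conv: "convex_on {0..} f" and f: "\<And>k. f (real k) = a + c * real k" and x: "0 \<le> x"
  shows "f x = a + c * x"
proof -
  define g where "g y = f y - (a + c * y)" for y
  have g: "convex_on {0..} g"
    unfolding g_def by (intro convex_on_diff conv) (auto simp: concave_on_def convex_on_alt algebra_simps)
  have g0: "g (real k) = 0" for k by (simp add: g_def f)
  obtain k where k: "x < real k" using reals_Archimedean2 by blast
  have "g x = 0"
  proof (cases "x = 0")
    case False
    with x have x: "0 < x" by simp
    have "(g x - g (real 0)) / (x - 0) \<le> (g (real k) - g x) / (real k - x)"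
      using convex_on_slopes_increase[OF g, of 0 "real k" x x] x k by simp
    then have "g x / x \<le> - g x / (real k - x)" by (simp only: g0) simp
    moreover have "(g (real k) - g x) / (real k - x) \<le> (g (real (Suc k)) - g (real k)) / (real (Suc k) - real k)"
      using x k by (intro convex_on_slopes_increase[OF g]) auto
    then have "- g x / (real k - x) \<le> 0" by (simp only: g0) simp
    ultimately show ?thesis
      using x k by (smt (verit) divide_neg_pos divide_pos_pos)
  qed (use g0[of 0] in simp)
  then show ?thesis by (simp add: g_def)
qed

text \<open>
  The increments over unit steps are the logarithms of the ratios of consecutive values of \<open>exp \<circ> f\<close> on
  \<open>\<nat>\<close>; this is how the second derivative controls the mass function. The first increment
  starts at 0, so differentiability is asked for at 0 too, while the sign of \<open>f2\<close> is known for \<open>y > 0\<close>;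
  continuity of \<open>f1\<close> at 0 bridges the gap.
\<close>
lemma mono_increments_of_second_derivative:
  fixes f f1 f2 :: "real \<Rightarrow> real"
  assumes f1: "\<And>y. 0 \<le> y \<Longrightarrow> (f has_real_derivative f1 y) (at y)"
    and f2: "\<And>y. 0 \<le> y \<Longrightarrow> (f1 has_real_derivative f2 y) (at y)"
    and nonneg: "\<And>y. 0 < y \<Longrightarrow> 0 \<le> f2 y" and nz: "0 < y0" "f2 y0 \<noteq> 0"
  shows "mono (\<lambda>k. f (real (Suc k)) - f (real k))"
    and "\<exists>i j. f (real (Suc i)) - f (real i) \<noteq> f (real (Suc j)) - f (real j)"
proof -
  have conv: "convex_on {0..} f"
  proof (rule convex_on_realI)
    show "connected {0::real..}" by simp
    show "(f has_real_derivative f1 x) (at x)" if "x \<in> {0..}" for x using f1 that by simp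
    fix x y :: real assume xy: "x \<in> {0..}" "y \<in> {0..}" "x \<le> y"
    show "f1 x \<le> f1 y"
    proof (rule DERIV_nonneg_imp_increasing_open[OF xy(3)])
      fix z assume "x < z" "z < y"
      then show "\<exists>w. (f1 has_real_derivative w) (at z) \<and> 0 \<le> w"
        using f2[of z] nonneg[of z] xy by (intro exI[of _ "f2 z"]) auto
    next
      show "continuous_on {x..y} f1"
        by (rule DERIV_continuous_on[OF has_field_derivative_at_within[OF f2]]) (use xy in auto)
    qed
  qed
  show "mono (\<lambda>k. f (real (Suc k)) - f (real k))"
  proof (rule mono_iff_le_Suc[THEN iffD2], rule allI)
    fix k
    show "f (real (Suc k)) - f (real k) \<le> f (real (Suc (Suc k))) - f (real (Suc k))"
      using convex_on_slopes_increase[OF conv, of "real k" "real (Suc (Suc k))" "real (Suc k)" "real (Suc k)"]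
      by simp
  qed
  \<comment> \<open>Constant increments would make \<open>f\<close> affine on \<open>\<nat>\<close>, hence everywhere, and \<open>f2\<close> would vanish.\<close>
  show "\<exists>i j. f (real (Suc i)) - f (real i) \<noteq> f (real (Suc j)) - f (real j)"
  proof (rule ccontr)
    assume "\<not> ?thesis"
    then have eq: "f (real (Suc k)) - f (real k) = f 1 - f 0" for k
      by (metis of_nat_0 of_nat_1 One_nat_def)
    have fk: "f (real k) = f 0 + (f 1 - f 0) * real k" for k
    proof (induction k)
      case (Suc k)
      then show ?case using eq[of k] by (simp add: algebra_simps)
    qed simp
    have aff: "f y = f 0 + (f 1 - f 0) * y" if "0 \<le> y" for y
      by (rule affine_if_convex_and_affine_on_nat[OF conv fk that])
    have nhds: "eventually (\<lambda>y. y \<in> {0<..}) (nhds z)" if "0 < z" for z :: real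
      using that by (intro eventually_nhds_in_open) auto
    have f1c: "f1 z = f 1 - f 0" if "0 < z" for z
    proof -
      have "eventually (\<lambda>y. f y = f 0 + (f 1 - f 0) * y) (nhds z)"
        using nhds[OF that] by eventually_elim (rule aff, simp)
      from DERIV_cong_ev[OF refl this refl]
      have "((\<lambda>y. f 0 + (f 1 - f 0) * y) has_real_derivative f1 z) (at z)"
        using f1[of z] that by simp
      moreover have "((\<lambda>y. f 0 + (f 1 - f 0) * y) has_real_derivative f 1 - f 0) (at z)"
        by (auto intro!: derivative_eq_intros)
      ultimately show ?thesis by (rule DERIV_unique)
    qed
    have "eventually (\<lambda>y. f1 y = f 1 - f 0) (nhds y0)"
      using nhds[OF nz(1)] by eventually_elim (use f1c in auto)
    from DERIV_cong_ev[OF refl this refl]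
    have "((\<lambda>y. f 1 - f 0) has_real_derivative f2 y0) (at y0)"
      using f2[of y0] nz by simp
    then have "f2 y0 = 0" by (rule DERIV_unique) simp
    with nz show False by simp
  qed
qed

section \<open>Log-convex solutions of a gamma-type functional equation\<close>

lemma tendsto_0_shifted_difference:
  fixes L :: "real \<Rightarrow> real"
  assumes "(\<lambda>n. L (real (Suc n)) - L (real n)) \<longlonglongrightarrow> 0"
  shows "(\<lambda>n. L (real (n + N)) - L (real n)) \<longlonglongrightarrow> 0"
proof (induction N)
  case (Suc N)
  have "(\<lambda>n. L (real (Suc (n + N))) - L (real (n + N))) \<longlonglongrightarrow> 0"
    using LIMSEQ_ignore_initial_segment[OF assms, of N] by simp
  from tendsto_add[OF this Suc] show ?case by simp
qed simp

text \<open>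
  The uniqueness half of the Bohr-Mollerup theorem, for a general functional equation
  \<open>g (x + 1) = L x + g x\<close> in place of \<open>L = ln\<close>. Convexity determines \<open>g\<close> near infinity up to \<open>o(1)\<close>, because
  its unit increments there hardly change, and the functional equation carries this back to \<open>x\<close>.
\<close>
lemma bohr_mollerup_limit:
  fixes g L :: "real \<Rightarrow> real"
  assumes conv: "convex_on {0<..} g"
    and rec: "\<And>x. x > 0 \<Longrightarrow> g (x + 1) = L x + g x"
    and lim: "(\<lambda>n. L (real (Suc n)) - L (real n)) \<longlonglongrightarrow> 0"
    and x: "x > 0"
  shows "(\<lambda>n. x * L (real (Suc n)) + (\<Sum>k=1..n. L (real k)) - (\<Sum>k\<le>n. L (real k + x)))
    \<longlonglongrightarrow> g x - g 1"
proof -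
  \<comment> \<open>The error \<open>E\<close> compares the slope of \<open>g\<close> over \<open>[n + 1, n + 1 + x]\<close> with \<open>L (n + 1)\<close>. Convexity
    squeezes that slope between the unit increments of \<open>g\<close>, which are values of \<open>L\<close>, just before
    \<open>n + 1\<close> and at \<open>n + 1 + N\<close>.\<close>
  define E where "E n = g (real (Suc n) + x) - g (real (Suc n)) - x * L (real (Suc n))" for n
  have gx: "g (real (Suc n) + x) = g x + (\<Sum>k\<le>n. L (real k + x))" for n
  proof (induction n)
    case (Suc n)
    then show ?case using rec[of "real (Suc n) + x"] x by (simp add: algebra_simps)
  qed (use rec[OF x] in \<open>simp add: algebra_simps\<close>)
  have g1: "g (real (Suc n)) = g 1 + (\<Sum>k=1..n. L (real k))" for n
  proof (induction n)
    case (Suc n)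
    then show ?case using rec[of "real (Suc n)"] by (simp add: algebra_simps)
  qed simp
  obtain N :: nat where N: "x < real N" using reals_Archimedean2 by blast
  have lower: "- x * (L (real (Suc (Suc n))) - L (real (Suc n))) \<le> E (Suc n)" for n
  proof -
    let ?m = "real (Suc (Suc n))"
    have "(g ?m - g (?m - 1)) / (?m - (?m - 1)) \<le> (g (?m + x) - g ?m) / (?m + x - ?m)"
      using x by (intro convex_on_slopes_increase[OF conv]) auto
    then have "g ?m - g (?m - 1) \<le> (g (?m + x) - g ?m) / x" by simp
    moreover have "g ?m - g (?m - 1) = L (real (Suc n))" using rec[of "real (Suc n)"] by (simp add: add.commute)
    ultimately show ?thesis using x by (simp add: E_def field_simps)
  qed
  have upper: "E (Suc n) \<le> x * (L (real (Suc (Suc n) + N)) - L (real (Suc (Suc n))))" for n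
  proof -
    let ?m = "real (Suc (Suc n))"
    have "(g (?m + x) - g ?m) / (?m + x - ?m)
        \<le> (g (?m + real N + 1) - g (?m + real N)) / (?m + real N + 1 - (?m + real N))"
      using x N by (intro convex_on_slopes_increase[OF conv]) auto
    then have "(g (?m + x) - g ?m) / x \<le> g (?m + real N + 1) - g (?m + real N)" by simp
    also have "\<dots> = L (?m + real N)" using rec[of "?m + real N"] by simp
    finally show ?thesis using x by (simp add: E_def field_simps)
  qed
  have "(\<lambda>n. E (Suc n)) \<longlonglongrightarrow> 0"
  proof (rule tendsto_sandwich[OF always_eventually always_eventually])
    show "(\<lambda>n. - x * (L (real (Suc (Suc n))) - L (real (Suc n)))) \<longlonglongrightarrow> 0"
      using tendsto_mult[OF tendsto_const[of "- x"] LIMSEQ_Suc[OF lim]] by simp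
    show "(\<lambda>n. x * (L (real (Suc (Suc n) + N)) - L (real (Suc (Suc n))))) \<longlonglongrightarrow> 0"
      using tendsto_mult[OF tendsto_const[of x]
          LIMSEQ_Suc[OF LIMSEQ_Suc[OF tendsto_0_shifted_difference[OF lim, of N]]]] by simp
  qed (use lower upper in auto)
  then have "E \<longlonglongrightarrow> 0" by (rule LIMSEQ_imp_Suc)
  then have "(\<lambda>n. g x - g 1 - E n) \<longlonglongrightarrow> g x - g 1 - 0" by (intro tendsto_intros)
  moreover have "g x - g 1 - E n =
      x * L (real (Suc n)) + (\<Sum>k=1..n. L (real k)) - (\<Sum>k\<le>n. L (real k + x))" for n
    by (simp only: E_def gx g1)
  ultimately show ?thesis by simp
qed

text \<open>
  The series is the general form of the Weierstrass expansion of \<open>ln \<Gamma>\<close>. The second derivatives of its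
  terms are \<open>- L2 (k + 1 + x) = O(1 / k\<^sup>2)\<close>, and one mean value argument shows that the first derivatives are
  also \<open>O(1 / k\<^sup>2)\<close>, locally uniformly; hence termwise differentiation is justified twice.
\<close>
lemma log_gamma_series_twice_differentiable:
  fixes L L1 L2 :: "real \<Rightarrow> real"
  assumes L1: "\<And>x. x > 0 \<Longrightarrow> (L has_real_derivative L1 x) (at x)"
    and L2: "\<And>x. x > 0 \<Longrightarrow> (L1 has_real_derivative L2 x) (at x)"
    and bound: "\<And>x. x > 0 \<Longrightarrow> \<bar>L2 x\<bar> \<le> C / x\<^sup>2"
  obtains S S1 S2 where
    "\<And>x. x > 0 \<Longrightarrow>
      (\<lambda>k. x * (L (real (Suc k) + 1) - L (real (Suc k))) - (L (real (Suc k) + x) - L (real (Suc k)))) sums S x"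
    "\<And>x. x > 0 \<Longrightarrow> (S has_real_derivative S1 x) (at x)"
    "\<And>x. x > 0 \<Longrightarrow> (S1 has_real_derivative S2 x) (at x)"
proof -
  define t where "t k x = x * (L (real (Suc k) + 1) - L (real (Suc k))) - (L (real (Suc k) + x) - L (real (Suc k)))"
    for k x
  define t1 where "t1 k x = (L (real (Suc k) + 1) - L (real (Suc k))) - L1 (real (Suc k) + x)" for k x
  define t2 where "t2 k x = - L2 (real (Suc k) + x)" for k x
  have dt: "(t k has_real_derivative t1 k x) (at x)" if "x > 0" for k x
    unfolding t_def t1_def using that
    by (auto intro!: derivative_eq_intros DERIV_chain2[OF L1])
  have dt1: "(t1 k has_real_derivative t2 k x) (at x)" if "x > 0" for k x
    unfolding t1_def t2_def using that
    by (auto intro!: derivative_eq_intros DERIV_chain2[OF L2])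
  have C: "0 \<le> C" using bound[of 1] by simp
  have bound': "\<bar>L2 z\<bar> \<le> C / (real (Suc k))\<^sup>2" if "z > real (Suc k)" for z k
  proof -
    have "C / z\<^sup>2 \<le> C / (real (Suc k))\<^sup>2" using that C by (intro divide_left_mono power_mono mult_pos_pos zero_less_power) auto
    then show ?thesis using bound[of z] that by simp
  qed
  \<comment> \<open>By the mean value theorem \<open>t1 k x\<close> is a difference of two values of \<open>L1\<close> at distance at most
    \<open>1 + B\<close>, both to the right of \<open>k + 1\<close>.\<close>
  have t1_le: "\<bar>t1 k x\<bar> \<le> (1 + B) * (C / (real (Suc k))\<^sup>2)" if "0 < x" "x < B" for k x B
  proof -
    have "\<exists>z. real (Suc k) < z \<and> z < real (Suc k) + 1 \<and>
        L (real (Suc k) + 1) - L (real (Suc k)) = (real (Suc k) + 1 - real (Suc k)) * L1 z"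
      by (rule MVT2) (auto intro!: L1)
    then obtain z where z: "real (Suc k) < z" "z < real (Suc k) + 1"
      and eq: "L (real (Suc k) + 1) - L (real (Suc k)) = L1 z" by auto
    have "norm (L1 z - L1 (real (Suc k) + x)) \<le> C / (real (Suc k))\<^sup>2 * norm (z - (real (Suc k) + x))"
      by (rule field_differentiable_bound[of "{real (Suc k)<..}" L1 L2])
         (use z that bound' in \<open>auto intro!: has_field_derivative_at_within[OF L2]\<close>)
    also have "\<dots> \<le> C / (real (Suc k))\<^sup>2 * (1 + B)"
      using C z that by (intro mult_left_mono) auto
    finally show ?thesis unfolding t1_def eq real_norm_def by (simp only: mult.commute)
  qed
  have t2_le: "\<bar>t2 k x\<bar> \<le> C / (real (Suc k))\<^sup>2" if "0 < x" for k x
    using bound'[of k "real (Suc k) + x"] that by (simp add: t2_def)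
  have sq: "summable (\<lambda>k. C / (real (Suc k))\<^sup>2)"
    using summable_mult[OF inverse_power_summable[of 2, where 'a=real], of C]
    by (subst summable_Suc_iff[of "\<lambda>k. C / (real k)\<^sup>2"]) (simp add: divide_inverse)
  have local: "summable (\<lambda>k. t k x) \<and> ((\<lambda>x. \<Sum>k. t k x) has_real_derivative (\<Sum>k. t1 k x)) (at x) \<and>
    ((\<lambda>x. \<Sum>k. t1 k x) has_real_derivative (\<Sum>k. t2 k x)) (at x)" if x: "x > 0" for x
  proof -
    \<comment> \<open>The bound on \<open>t1\<close> is uniform only on bounded sets. The interval reaches beyond 1 because \<open>t k 1 = 0\<close>
      provides the point where the series of the \<open>t k\<close> converges.\<close>
    let ?I = "{0<..<x + 2}"
    have u2: "uniformly_convergent_on ?I (\<lambda>n y. \<Sum>k<n. t2 k y)"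
      by (rule Weierstrass_m_test'[OF _ sq]) (use t2_le in auto)
    have u1: "uniformly_convergent_on ?I (\<lambda>n y. \<Sum>k<n. t1 k y)"
      by (rule Weierstrass_m_test'[OF _ summable_mult[OF sq, of "1 + (x + 2)"]]) (use t1_le[of _ "x + 2"] in auto)
    have s1: "summable (\<lambda>k. t1 k 1)"
      by (rule summable_comparison_test'[OF summable_mult[OF sq, of "1 + 2"], of 0]) (use t1_le[of 1 2] in auto)
    have s0: "summable (\<lambda>k. t k 1)" by (simp add: t_def)
    have I: "convex ?I" "1 \<in> ?I" "x \<in> interior ?I" using x by auto
    show ?thesis
      using has_field_derivative_series'[OF I(1) has_field_derivative_at_within[OF dt] u1 I(2) s0 I(3)]
        has_field_derivative_series'[OF I(1) has_field_derivative_at_within[OF dt1] u2 I(2) s1 I(3)]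
      by auto
  qed
  show thesis
    using that[of "\<lambda>x. \<Sum>k. t k x" "\<lambda>x. \<Sum>k. t1 k x" "\<lambda>x. \<Sum>k. t2 k x"] local
    by (auto simp: t_def summable_sums)
qed

section \<open>Bernstein-gamma functions\<close>

text \<open>
  A Bernstein function is increasing and concave and its second derivative increases; comparing values
  at \<open>x/2\<close> and \<open>x\<close> gives \<open>\<phi>' x \<le> 2 \<phi> x / x\<close> and \<open>- \<phi>'' x \<le> 8 \<phi> x / x\<^sup>2\<close>. The constant 12 is \<open>8 + 2\<^sup>2\<close>, from
  \<open>(ln \<phi>)'' = \<phi>''/\<phi> - (\<phi>'/\<phi>)\<^sup>2\<close>.
\<close>
lemma bernstein_log_derivatives:
  assumes bern: "bernstein_function \<phi>" and pos: "\<And>x. x > 0 \<Longrightarrow> 0 < \<phi> x"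
  obtains L1 L2 where
    "\<And>x. x > 0 \<Longrightarrow> ((\<lambda>x. ln (\<phi> x)) has_real_derivative L1 x) (at x)"
    "\<And>x. x > 0 \<Longrightarrow> (L1 has_real_derivative L2 x) (at x)"
    "\<And>x. x > 0 \<Longrightarrow> 0 \<le> L1 x \<and> L1 x \<le> 2 / x"
    "\<And>x. x > 0 \<Longrightarrow> \<bar>L2 x\<bar> \<le> 12 / x\<^sup>2"
proof -
  define d where "d n = (deriv ^^ n) \<phi>" for n
  have d0: "d 0 = \<phi>" by (simp add: d_def)
  have der: "(d n has_real_derivative d (Suc n) x) (at x)" if "x > 0" for n x
  proof -
    have "d n differentiable at x" using bern that by (simp add: bernstein_function_def d_def)
    then have "(d n has_real_derivative deriv (d n) x) (at x)"
      by (simp add: DERIV_deriv_iff_real_differentiable)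
    then show ?thesis by (simp add: d_def)
  qed
  have sgn: "0 \<le> (-1) ^ n * d (Suc n) x" if "x > 0" for n x
    using bern that unfolding bernstein_function_def d_def by (metis diff_Suc_1 le_add1 plus_1_eq_Suc)
  have d1: "0 \<le> d 1 x" and d2: "d 2 x \<le> 0" and d3: "0 \<le> d 3 x" if "x > 0" for x
    using sgn[OF that, of 0] sgn[OF that, of 1] sgn[OF that, of 2] by (simp_all add: numeral_2_eq_2 numeral_3_eq_3)
  have d1_anti: "d 1 y \<le> d 1 x" if "0 < x" "x \<le> y" for x y
  proof (rule DERIV_nonpos_imp_nonincreasing[OF that(2)])
    fix z assume "x \<le> z" "z \<le> y"
    with that der[of z 1] d2[of z] show "\<exists>w. (d 1 has_real_derivative w) (at z) \<and> w \<le> 0"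
      by (intro exI[of _ "d 2 z"]) (auto simp: numeral_3_eq_3 numeral_2_eq_2)
  qed
  have d2_mono: "d 2 x \<le> d 2 y" if "0 < x" "x \<le> y" for x y
  proof (rule DERIV_nonneg_imp_nondecreasing[OF that(2)])
    fix z assume "x \<le> z" "z \<le> y"
    with that der[of z 2] d3[of z] show "\<exists>w. (d 2 has_real_derivative w) (at z) \<and> 0 \<le> w"
      by (intro exI[of _ "d 3 z"]) (auto simp: numeral_3_eq_3 numeral_2_eq_2)
  qed
  \<comment> \<open>Both bounds use the mean value theorem on \<open>[x/2, x]\<close>, which stays away from the point 0, where a
    Bernstein function need not be differentiable.\<close>
  have first: "d 1 x \<le> 2 / x * \<phi> x" if x: "x > 0" for x
  proof -
    have "\<exists>z. x / 2 < z \<and> z < x \<and> \<phi> x - \<phi> (x / 2) = (x - x / 2) * d 1 z"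
      by (rule MVT2) (use x der[of _ 0] in \<open>auto simp: d0\<close>)
    then obtain z where z: "x / 2 < z" "z < x" "\<phi> x - \<phi> (x / 2) = (x - x / 2) * d 1 z" by blast
    then have "x / 2 * d 1 x \<le> x / 2 * d 1 z" using x by (intro mult_left_mono d1_anti) auto
    also have "\<dots> \<le> \<phi> x" using z pos[of "x / 2"] x by simp
    finally show ?thesis using x by (simp add: field_simps)
  qed
  have second: "- d 2 x \<le> 8 / x\<^sup>2 * \<phi> x" if x: "x > 0" for x
  proof -
    have "\<exists>z. x / 2 < z \<and> z < x \<and> d 1 x - d 1 (x / 2) = (x - x / 2) * d 2 z"
      by (rule MVT2) (use x der[of _ 1] in \<open>auto simp: numeral_2_eq_2\<close>)
    then obtain z where z: "x / 2 < z" "z < x" "d 1 x - d 1 (x / 2) = (x - x / 2) * d 2 z" by blast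
    have "- (x / 2 * d 2 x) \<le> - (x / 2 * d 2 z)" using x z by (simp add: d2_mono)
    also have "\<dots> \<le> d 1 (x / 2)" using z d1[OF x] by simp
    also have "\<dots> \<le> 4 / x * \<phi> (x / 2)" using first[of "x / 2"] x by simp
    also have "\<dots> \<le> 4 / x * \<phi> x"
    proof (intro mult_left_mono DERIV_nonneg_imp_nondecreasing[of "x / 2" x \<phi>])
      fix z assume "x / 2 \<le> z" "z \<le> x"
      with x der[of z 0] d1[of z] show "\<exists>w. (\<phi> has_real_derivative w) (at z) \<and> 0 \<le> w"
        by (intro exI[of _ "d 1 z"]) (auto simp: d0)
    qed (use x in auto)
    finally show ?thesis using x by (simp add: field_simps power2_eq_square)
  qed
  define L1 where "L1 x = d 1 x / \<phi> x" for x
  define L2 where "L2 x = d 2 x / \<phi> x - (L1 x)\<^sup>2" for x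
  have L1_bd: "0 \<le> L1 x \<and> L1 x \<le> 2 / x" if x: "x > 0" for x
    using first[OF x] d1[OF x] pos[OF x] x by (simp add: L1_def divide_simps)
  show thesis
  proof (rule that[of L1 L2])
    fix x :: real assume x: "x > 0"
    have phi: "(\<phi> has_real_derivative d 1 x) (at x)" using der[OF x, of 0] by (simp add: d0)
    have phi1: "(d 1 has_real_derivative d 2 x) (at x)" using der[OF x, of 1] by (simp add: numeral_2_eq_2)
    show "((\<lambda>x. ln (\<phi> x)) has_real_derivative L1 x) (at x)"
      using pos[OF x] unfolding L1_def by (auto intro!: derivative_eq_intros phi)
    have "((\<lambda>x. d 1 x / \<phi> x) has_real_derivative (d 2 x * \<phi> x - d 1 x * d 1 x) / (\<phi> x * \<phi> x)) (at x)"
      using pos[OF x] by (intro DERIV_divide phi phi1) auto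
    also have "(d 2 x * \<phi> x - d 1 x * d 1 x) / (\<phi> x * \<phi> x) = L2 x"
      using pos[OF x] by (simp add: L2_def L1_def field_simps power2_eq_square)
    finally show "(L1 has_real_derivative L2 x) (at x)" by (simp add: L1_def[abs_def])
    show "0 \<le> L1 x \<and> L1 x \<le> 2 / x" by (rule L1_bd[OF x])
    have "(L1 x)\<^sup>2 \<le> (2 / x)\<^sup>2" using L1_bd[OF x] by (intro power_mono) auto
    moreover have "- (d 2 x / \<phi> x) \<le> 8 / x\<^sup>2" "d 2 x / \<phi> x \<le> 0"
      using second[OF x] d2[OF x] pos[OF x] x by (simp_all add: field_simps)
    moreover have "0 \<le> 12 / x\<^sup>2" "8 / x\<^sup>2 + (2 / x)\<^sup>2 = 12 / x\<^sup>2" by (simp_all add: power_divide flip: add_divide_distrib)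
    ultimately show "\<bar>L2 x\<bar> \<le> 12 / x\<^sup>2"
      unfolding L2_def using zero_le_power2[of "L1 x"] by linarith
  qed
qed

lemma positive_definite_cauchy_schwarz:
  assumes W: "positive_definite W" and x: "0 < x" and y: "0 < y"
  shows "0 \<le> W x" "(W ((x + y) / 2))\<^sup>2 \<le> W x * W y"
proof -
  have nonneg: "0 \<le> W z" if "0 < z" for z
  proof -
    have "0 \<le> (\<Sum>i<1::nat. \<Sum>j<1::nat. 1 * 1 * W (z / 2 + z / 2))"
      using W that unfolding positive_definite_def
      by (elim conjE allE[of _ 1] allE[of _ "\<lambda>_. z / 2"] allE[of _ "\<lambda>_. 1"]) simp
    then show ?thesis by simp
  qed
  show "0 \<le> W x" by (rule nonneg[OF x])
  let ?m = "W ((x + y) / 2)"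
  \<comment> \<open>Positive definiteness is tested on the half points, whose pairwise sums are \<open>x\<close>, \<open>y\<close> and the midpoint.\<close>
  have quad: "0 \<le> a\<^sup>2 * W x + 2 * a * b * ?m + b\<^sup>2 * W y" for a b
  proof -
    define u c where "u i = (if i = 0 then x / 2 else y / 2)" and "c i = (if i = 0 then a else b)" for i :: nat
    have "0 \<le> (\<Sum>i<2::nat. \<Sum>j<2::nat. c i * c j * W (u i + u j))"
      using W x y unfolding positive_definite_def by (auto simp: u_def)
    moreover have "x / 2 + y / 2 = (x + y) / 2" "y / 2 + x / 2 = (x + y) / 2" by simp_all
    ultimately show ?thesis
      by (simp add: numeral_2_eq_2 u_def c_def power2_eq_square algebra_simps)
  qed
  show "?m\<^sup>2 \<le> W x * W y"
  proof (cases "W x = 0")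
    case True
    have "?m = 0"
    proof (rule ccontr)
      assume m: "?m \<noteq> 0"
      have "0 \<le> 2 * (- (W y + 1) / (2 * ?m)) * 1 * ?m + 1\<^sup>2 * W y"
        using quad[of "- (W y + 1) / (2 * ?m)" 1] True by simp
      also have "\<dots> = -1" using m by (simp add: field_simps)
      finally show False by simp
    qed
    then show ?thesis using True by simp
  next
    case False
    then have "0 < W x" using nonneg[OF x] by simp
    moreover have "0 \<le> W x * (W x * W y - ?m\<^sup>2)"
      using quad[of "- ?m" "W x"] by (simp add: power2_eq_square algebra_simps)
    ultimately show ?thesis by (simp add: zero_le_mult_iff)
  qed
qed

text \<open>
  A zero of \<open>W\<close> at \<open>x\<close> would spread to the whole half-line beyond \<open>x/2\<close>, whereas the functional equation
  makes \<open>W\<close> positive at all positive integers.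
\<close>
lemma bernstein_gamma_pos:
  assumes W: "is_bernstein_gamma \<phi> W" and phi: "\<And>x. x > 0 \<Longrightarrow> 0 < \<phi> x" and x: "0 < x"
  shows "0 < W x"
proof (rule ccontr)
  have pd: "positive_definite W" and W1: "W 1 = 1" and rec: "\<And>x. 0 < x \<Longrightarrow> W (x + 1) = \<phi> x * W x"
    using W by (auto simp: is_bernstein_gamma_def)
  assume "\<not> 0 < W x"
  then have 0: "W x = 0" using positive_definite_cauchy_schwarz(1)[OF pd x x] by simp
  \<comment> \<open>By Cauchy-Schwarz a zero at \<open>x\<close> kills \<open>W\<close> at the midpoint of \<open>x\<close> and any other point.\<close>
  have zero: "W w = 0" if "x / 2 < w" for w
    using positive_definite_cauchy_schwarz(2)[OF pd x, of "2 * w - x"] that 0 by simp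
  have "0 < W (real (Suc n))" for n
  proof (induction n)
    case (Suc n)
    then show ?case using rec[of "real (Suc n)"] phi[of "real (Suc n)"] by (simp add: add.commute)
  qed (simp add: W1)
  moreover obtain n where "x / 2 < real (Suc n)"
    using reals_Archimedean2[of "x / 2"] by (metis less_trans of_nat_less_iff lessI)
  ultimately show False using zero by (metis less_irrefl)
qed

text \<open>
  The Cauchy-Schwarz inequality says that \<open>ln W\<close> is midpoint convex; continuity does the rest.
\<close>
lemma bernstein_gamma_log_convex:
  assumes W: "is_bernstein_gamma \<phi> W" and phi: "\<And>x. x > 0 \<Longrightarrow> 0 < \<phi> x"
  shows "convex_on {0<..} (\<lambda>x. ln (W x))"
proof (rule convex_on_of_midpoint_convex)
  have pd: "positive_definite W" using W by (simp add: is_bernstein_gamma_def)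
  have pos: "0 < W z" if "0 < z" for z using bernstein_gamma_pos[OF W phi that] by blast
  show "continuous_on {0<..} (\<lambda>x. ln (W x))"
    using pd pos by (intro continuous_on_ln) (auto simp: positive_definite_def less_le)
  fix x y :: real assume "x \<in> {0<..}" "y \<in> {0<..}"
  then have xy: "0 < x" "0 < y" by auto
  have "ln ((W ((x + y) / 2))\<^sup>2) \<le> ln (W x * W y)"
    using positive_definite_cauchy_schwarz(2)[OF pd xy] pos[of "(x + y) / 2"] xy by (intro ln_mono) auto
  then show "ln (W ((x + y) / 2)) \<le> (ln (W x) + ln (W y)) / 2"
    using pos[OF xy(1)] pos[OF xy(2)] pos[of "(x + y) / 2"] xy by (simp add: ln_mult ln_realpow)
qed auto

text \<open>
  Smoothness is not visible in the characterisation of \<open>W\<close>. It is obtained by showing that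
  \<open>ln W\<close> is the log-gamma series of \<open>L = ln \<phi>\<close>: \<open>ln W\<close> is convex and \<open>L (n + 1) - L n\<close> tends to 0
  because \<open>0 \<le> L' x \<le> 2 / x\<close>, so the Bohr-Mollerup limit applies, and that limit telescopes into the series.
\<close>
lemma bernstein_gamma_log_twice_differentiable:
  assumes bern: "bernstein_function \<phi>" and W: "is_bernstein_gamma \<phi> W"
    and phi: "\<And>x. x > 0 \<Longrightarrow> 0 < \<phi> x"
  obtains G1 G2 where
    "\<And>x. x > 0 \<Longrightarrow> ((\<lambda>x. ln (W x)) has_real_derivative G1 x) (at x)"
    "\<And>x. x > 0 \<Longrightarrow> (G1 has_real_derivative G2 x) (at x)"
proof -
  define L where "L x = ln (\<phi> x)" for x
  obtain L1 L2 where L1: "\<And>x. x > 0 \<Longrightarrow> (L has_real_derivative L1 x) (at x)"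
    and L2: "\<And>x. x > 0 \<Longrightarrow> (L1 has_real_derivative L2 x) (at x)"
    and L1_le: "\<And>x. x > 0 \<Longrightarrow> 0 \<le> L1 x \<and> L1 x \<le> 2 / x"
    and L2_le: "\<And>x. x > 0 \<Longrightarrow> \<bar>L2 x\<bar> \<le> 12 / x\<^sup>2"
    using bernstein_log_derivatives[OF bern phi] unfolding L_def by blast
  obtain S S1 S2 where
    S: "\<And>x. x > 0 \<Longrightarrow>
      (\<lambda>k. x * (L (real (Suc k) + 1) - L (real (Suc k))) - (L (real (Suc k) + x) - L (real (Suc k)))) sums S x"
    and S1: "\<And>x. x > 0 \<Longrightarrow> (S has_real_derivative S1 x) (at x)"
    and S2: "\<And>x. x > 0 \<Longrightarrow> (S1 has_real_derivative S2 x) (at x)"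
    using log_gamma_series_twice_differentiable[OF L1 L2 L2_le] by blast
  have step: "0 \<le> L (real (Suc (Suc n))) - L (real (Suc n)) \<and>
      L (real (Suc (Suc n))) - L (real (Suc n)) \<le> 2 / real (Suc n)" for n
  proof -
    have "\<exists>z. real (Suc n) < z \<and> z < real (Suc (Suc n)) \<and>
        L (real (Suc (Suc n))) - L (real (Suc n)) = (real (Suc (Suc n)) - real (Suc n)) * L1 z"
      by (rule MVT2) (auto intro!: L1)
    then obtain z where z: "real (Suc n) < z" "L (real (Suc (Suc n))) - L (real (Suc n)) = L1 z" by auto
    moreover have "2 / z \<le> 2 / real (Suc n)" using z by (intro divide_left_mono) auto
    ultimately show ?thesis using L1_le[of z] by auto
  qed
  have "(\<lambda>n. L (real (Suc (Suc n))) - L (real (Suc n))) \<longlonglongrightarrow> 0"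
  proof (rule tendsto_sandwich[where f = "\<lambda>_. 0" and h = "\<lambda>n. 2 / real (Suc n)"])
    show "(\<lambda>n. 2 / real (Suc n)) \<longlonglongrightarrow> 0" by (rule LIMSEQ_Suc[OF lim_const_over_n])
  qed (use step in auto)
  then have lim: "(\<lambda>n. L (real (Suc n)) - L (real n)) \<longlonglongrightarrow> 0"
    by (rule LIMSEQ_imp_Suc)
  have pos: "0 < W z" if "0 < z" for z using bernstein_gamma_pos[OF W phi that] by blast
  have rec: "ln (W (x + 1)) = L x + ln (W x)" if "x > 0" for x
    using W that phi[OF that] pos[OF that]
    by (simp add: is_bernstein_gamma_def L_def ln_mult)
  have W1: "ln (W 1) = 0" using W by (simp add: is_bernstein_gamma_def)
  have conv: "convex_on {0<..} (\<lambda>x. ln (W x))" by (rule bernstein_gamma_log_convex[OF W phi])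
  have lnW: "ln (W x) = x * L 1 - L x + S x" if x: "x > 0" for x
  proof -
    have tele: "x * L (real (Suc n)) + (\<Sum>k=1..n. L (real k)) - (\<Sum>k\<le>n. L (real k + x)) =
      x * L 1 - L x +
      (\<Sum>k<n. x * (L (real (Suc k) + 1) - L (real (Suc k))) - (L (real (Suc k) + x) - L (real (Suc k))))" for n
      by (induction n) (simp_all add: algebra_simps)
    have "(\<lambda>n. x * L 1 - L x +
        (\<Sum>k<n. x * (L (real (Suc k) + 1) - L (real (Suc k))) - (L (real (Suc k) + x) - L (real (Suc k)))))
        \<longlonglongrightarrow> x * L 1 - L x + S x"
      using S[OF x] by (intro tendsto_intros) (simp add: sums_def)
    moreover have "(\<lambda>n. x * L 1 - L x +
        (\<Sum>k<n. x * (L (real (Suc k) + 1) - L (real (Suc k))) - (L (real (Suc k) + x) - L (real (Suc k)))))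
        \<longlonglongrightarrow> ln (W x)"
      using bohr_mollerup_limit[where L = L, OF conv rec lim x] W1 unfolding tele by simp
    ultimately show ?thesis by (rule LIMSEQ_unique[symmetric])
  qed
  show thesis
  proof (rule that[of "\<lambda>x. L 1 - L1 x + S1 x" "\<lambda>x. - L2 x + S2 x"])
    fix x :: real assume x: "x > 0"
    have der: "((\<lambda>x. x * L 1 - L x + S x) has_real_derivative L 1 - L1 x + S1 x) (at x)"
      using x by (auto intro!: derivative_eq_intros L1 S1)
    have "eventually (\<lambda>x. x \<in> {0<..}) (nhds x)" using x by (intro eventually_nhds_in_open) auto
    then have ev: "eventually (\<lambda>x. ln (W x) = x * L 1 - L x + S x) (nhds x)"
      by eventually_elim (simp add: lnW)
    show "((\<lambda>x. ln (W x)) has_real_derivative L 1 - L1 x + S1 x) (at x)"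
      using DERIV_cong_ev[OF refl ev refl] der by simp
    show "((\<lambda>x. L 1 - L1 x + S1 x) has_real_derivative - L2 x + S2 x) (at x)"
      using x by (auto intro!: derivative_eq_intros L2 S2)
  qed
qed

section \<open>Gamma functions of eventually log-convex functions\<close>

text \<open>
  A limit of positive numbers could be 0. The logarithm \<open>u\<close> of the approximants is kept from diverging
  to \<open>-\<infinity>\<close> by convexity of \<open>ln \<phi>\<close>: after adding a correction that tends to 0, it is eventually increasing.
\<close>
lemma limit_gamma_pos:
  assumes phi: "\<And>x. x > 0 \<Longrightarrow> 0 < \<phi> x" and conv: "eventually_log_convex \<phi>"
    and ratio: "(\<lambda>n. \<phi> (real n) / \<phi> (real (n + 1))) \<longlonglongrightarrow> 1"
    and W: "is_limit_gamma \<phi> W" and x: "0 < x"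
  shows "0 < W x"
proof -
  define L where "L y = ln (\<phi> y)" for y
  obtain m where L: "convex_on ({m<..} \<inter> {0<..}) L"
    using conv by (auto simp: eventually_log_convex_def L_def[abs_def])
  have "(\<lambda>n. - ln (\<phi> (real (Suc n)) / \<phi> (real (Suc (Suc n))))) \<longlonglongrightarrow> - ln 1"
    using LIMSEQ_Suc[OF ratio] by (intro tendsto_intros) auto
  moreover have "- ln (\<phi> (real (Suc n)) / \<phi> (real (Suc (Suc n)))) = L (real (Suc (Suc n))) - L (real (Suc n))" for n
    using phi[of "real (Suc n)"] phi[of "real (Suc (Suc n))"] by (simp add: L_def ln_div)
  ultimately have "(\<lambda>n. L (real (Suc (Suc n))) - L (real (Suc n))) \<longlonglongrightarrow> 0" by simp
  then have lim: "(\<lambda>n. L (real (Suc n)) - L (real n)) \<longlonglongrightarrow> 0" by (rule LIMSEQ_imp_Suc)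
  define u where "u n = x * L (real n) + (\<Sum>k=1..n. L (real k)) - (\<Sum>k=0..n. L (real k + x))" for n
  have exp_u: "(\<Prod>k=1..n. \<phi> (real k)) * \<phi> (real n) powr x / (\<Prod>k=0..n. \<phi> (real k + x)) = exp (u n)"
    if "n \<ge> 1" for n
  proof -
    have "(\<Prod>k=1..n. \<phi> (real k)) = exp (\<Sum>k=1..n. L (real k))"
      unfolding exp_sum[OF finite_atLeastAtMost] by (intro prod.cong) (use phi in \<open>auto simp: L_def\<close>)
    moreover have "(\<Prod>k=0..n. \<phi> (real k + x)) = exp (\<Sum>k=0..n. L (real k + x))"
      unfolding exp_sum[OF finite_atLeastAtMost] by (intro prod.cong) (use phi x in \<open>auto simp: L_def\<close>)
    moreover have "\<phi> (real n) powr x = exp (x * L (real n))"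
      using phi[of "real n"] that by (simp add: powr_def L_def)
    ultimately show ?thesis by (simp add: u_def exp_add exp_diff)
  qed
  \<comment> \<open>The increment of \<open>u\<close> at \<open>n\<close> is \<open>x\<close> times the difference of a slope of \<open>L\<close> over \<open>[n, n + 1]\<close> and one over
    \<open>[n + 1, n + 1 + x]\<close>. Since \<open>N > 1 + x\<close>, the latter is at most the slope over \<open>[n + N, n + N + 1]\<close>,
    and the resulting lower bound telescopes into the correction \<open>x * D\<close>.\<close>
  obtain N :: nat where N: "1 + x < real N" using reals_Archimedean2 by blast
  obtain n0 :: nat where n0: "m < real n0" using reals_Archimedean2 by blast
  define D where "D n = L (real (n + N)) - L (real n)" for n
  have D: "D \<longlonglongrightarrow> 0" unfolding D_def by (rule tendsto_0_shifted_difference[OF lim])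
  have step: "u n + x * D n \<le> u (Suc n) + x * D (Suc n)" if "n \<ge> n0" for n
  proof -
    have "(L (real (Suc n) + x) - L (real (Suc n))) / (real (Suc n) + x - real (Suc n))
        \<le> (L (real (n + N) + 1) - L (real (n + N))) / (real (n + N) + 1 - real (n + N))"
      using that n0 N x by (intro convex_on_slopes_increase[OF L]) auto
    then have "L (real (Suc n) + x) - L (real (Suc n)) \<le> x * (L (real (n + N) + 1) - L (real (n + N)))"
      using x by (simp add: field_simps)
    moreover have "u (Suc n) = u n + x * (L (real (Suc n)) - L (real n)) + L (real (Suc n)) - L (real (Suc n) + x)"
      by (simp add: u_def algebra_simps)
    ultimately show ?thesis by (simp add: D_def algebra_simps)
  qed
  define q where "q = u n0 + x * D n0"
  have q: "q \<le> u n + x * D n" if "n \<ge> n0" for n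
    using that by (induction rule: dec_induct) (use step in \<open>auto simp: q_def intro: order_trans\<close>)
  have "(\<lambda>n. exp (q - x * D n)) \<longlonglongrightarrow> exp (q - x * 0)" by (intro tendsto_intros D)
  moreover have "(\<lambda>n. (\<Prod>k=1..n. \<phi> (real k)) * \<phi> (real n) powr x / (\<Prod>k=0..n. \<phi> (real k + x))) \<longlonglongrightarrow> W x"
    using W x by (simp add: is_limit_gamma_def)
  moreover have "exp (q - x * D n) \<le> (\<Prod>k=1..n. \<phi> (real k)) * \<phi> (real n) powr x / (\<Prod>k=0..n. \<phi> (real k + x))"
    if "n \<ge> max 1 n0" for n
    using q[of n] exp_u[of n] that by simp
  ultimately have "exp (q - x * 0) \<le> W x" by (intro LIMSEQ_le) blast+
  then show ?thesis using exp_gt_zero[of "q - x * 0"] by linarith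
qed

section \<open>The dispersion of X\<close>

text \<open>
  The only properties of \<open>V\<close> that enter the dispersion argument, and the place where its two types are
  treated together.
\<close>
lemma admissible_regular:
  assumes adm: "admissible \<phi> V" and y: "0 < y"
  shows "0 < V y" "((\<lambda>t. ln (V t)) has_real_derivative psi V y) (at y)" "psi V differentiable at y"
proof -
  have phi: "0 < \<phi> x" if "0 < x" for x using adm that by (simp add: admissible_def)
  have "0 < V y \<and> (\<lambda>t. ln (V t)) differentiable at y \<and> psi V differentiable at y"
  proof (cases "bernstein_function \<phi> \<and> is_bernstein_gamma \<phi> V")
    case True
    then obtain G1 G2 where G1: "\<And>x. x > 0 \<Longrightarrow> ((\<lambda>x. ln (V x)) has_real_derivative G1 x) (at x)"
      and G2: "\<And>x. x > 0 \<Longrightarrow> (G1 has_real_derivative G2 x) (at x)"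
      using bernstein_gamma_log_twice_differentiable[of \<phi> V] phi by blast
    have "eventually (\<lambda>x. x \<in> {0<..}) (nhds y)" using y by (intro eventually_nhds_in_open) auto
    then have ev: "eventually (\<lambda>x. psi V x = G1 x) (nhds y)"
      by eventually_elim (auto simp: psi_def intro!: DERIV_imp_deriv G1)
    have "(psi V has_real_derivative G2 y) (at y)"
      using DERIV_cong_ev[OF refl ev refl] G2[OF y] by simp
    moreover have "0 < V y" using bernstein_gamma_pos[of \<phi> V y] phi y True by blast
    ultimately show ?thesis using G1[OF y] by (auto simp: real_differentiable_def)
  next
    case False
    with adm have "eventually_log_convex \<phi>" "(\<lambda>n. \<phi> (real n) / \<phi> (real (n + 1))) \<longlonglongrightarrow> 1" "is_limit_gamma \<phi> V"
      and "(\<lambda>t. ln (V t)) differentiable at y" "psi V differentiable at y"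
      using y by (auto simp: admissible_def)
    then show ?thesis using limit_gamma_pos[of \<phi> V y] phi y by blast
  qed
  then show "0 < V y" "((\<lambda>t. ln (V t)) has_real_derivative psi V y) (at y)" "psi V differentiable at y"
    by (auto simp: psi_def DERIV_deriv_iff_real_differentiable)
qed

theorem proposition7p3:
  fixes \<alpha> \<beta> \<gamma> \<rho> :: real
    and \<phi> V :: "real \<Rightarrow> real"
    and M :: "'a measure"
    and X :: "'a \<Rightarrow> nat"
  assumes "\<alpha> > 0" and "\<beta> > 0" and "\<gamma> > 0" and "\<rho> > 0"
    and "admissible \<phi> V"
    and "summable (weight_term \<alpha> \<beta> \<gamma> V \<rho>)"
    and "prob_space M"
    and "X \<in> measurable M (count_space UNIV)"
    and "\<And>n. measure M {\<omega> \<in> space M. X \<omega> = n} = weight_term \<alpha> \<beta> \<gamma> V \<rho> n / Z \<alpha> \<beta> \<gamma> V \<rho>"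
  shows "(integrable M (\<lambda>\<omega>. real (X \<omega>)) \<and>
          (\<forall>y>0. deriv (\<lambda>t. Digamma (t + \<gamma>)) y \<ge> \<alpha> * deriv (\<lambda>t. psi V (\<alpha> * t + \<beta>)) y) \<and>
          (\<exists>y>0. deriv (\<lambda>t. Digamma (t + \<gamma>)) y \<noteq> \<alpha> * deriv (\<lambda>t. psi V (\<alpha> * t + \<beta>)) y)
            \<longrightarrow> overdispersed M (\<lambda>\<omega>. real (X \<omega>)))
       \<and> ((\<forall>y>0. deriv (\<lambda>t. Digamma (t + \<gamma>)) y \<le> \<alpha> * deriv (\<lambda>t. psi V (\<alpha> * t + \<beta>)) y) \<and>
          (\<exists>y>0. deriv (\<lambda>t. Digamma (t + \<gamma>)) y \<noteq> \<alpha> * deriv (\<lambda>t. psi V (\<alpha> * t + \<beta>)) y)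
            \<longrightarrow> underdispersed M (\<lambda>\<omega>. real (X \<omega>)))"
proof -
  interpret prob_space M by fact
  note par = \<open>\<alpha> > 0\<close> \<open>\<beta> > 0\<close> \<open>\<gamma> > 0\<close> \<open>\<rho> > 0\<close>
  note reg = admissible_regular[OF \<open>admissible \<phi> V\<close>]
  note X = \<open>X \<in> measurable M (count_space UNIV)\<close>
  let ?DG = "deriv (\<lambda>t. Digamma (t + \<gamma>))" and ?DV = "deriv (\<lambda>t. psi V (\<alpha> * t + \<beta>))"
  define f where "f y = ln_Gamma (y + \<gamma>) - ln (V (\<alpha> * y + \<beta>))" for y
  define f1 where "f1 y = Digamma (y + \<gamma>) - \<alpha> * psi V (\<alpha> * y + \<beta>)" for y
  define f2 where "f2 y = ?DG y - \<alpha> * ?DV y" for y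
  have arg: "0 < \<alpha> * y + \<beta>" if "0 \<le> y" for y
    using par that by (simp add: add_nonneg_pos)
  have f1: "(f has_real_derivative f1 y) (at y)" if "0 \<le> y" for y
  proof -
    have "((\<lambda>y. ln (V (\<alpha> * y + \<beta>))) has_real_derivative psi V (\<alpha> * y + \<beta>) * \<alpha>) (at y)"
      by (rule DERIV_chain2[where f = "\<lambda>t. ln (V t)" and g = "\<lambda>y. \<alpha> * y + \<beta>", OF reg(2)[OF arg[OF that]]])
         (auto intro!: derivative_eq_intros)
    moreover have "((\<lambda>y. ln_Gamma (y + \<gamma>)) has_real_derivative Digamma (y + \<gamma>)) (at y)"
      using par that by (auto intro!: derivative_eq_intros)
    ultimately show ?thesis
      unfolding f_def f1_def by (subst mult.commute) (rule DERIV_diff)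
  qed
  have f2: "(f1 has_real_derivative f2 y) (at y)" if "0 \<le> y" for y
  proof -
    have "(psi V has_real_derivative deriv (psi V) (\<alpha> * y + \<beta>)) (at (\<alpha> * y + \<beta>))"
      using reg(3)[OF arg[OF that]] by (simp add: DERIV_deriv_iff_real_differentiable)
    then have "((\<lambda>t. psi V (\<alpha> * t + \<beta>)) has_real_derivative deriv (psi V) (\<alpha> * y + \<beta>) * \<alpha>) (at y)"
      by (rule DERIV_chain2[where f = "psi V" and g = "\<lambda>t. \<alpha> * t + \<beta>"]) (auto intro!: derivative_eq_intros)
    then have V': "((\<lambda>t. psi V (\<alpha> * t + \<beta>)) has_real_derivative ?DV y) (at y)"
      using DERIV_imp_deriv by fastforce
    have "y + \<gamma> \<notin> \<int>\<^sub>\<le>\<^sub>0" using par that by (auto elim!: nonpos_Ints_cases)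
    then have "((\<lambda>t. Digamma (t + \<gamma>)) has_real_derivative Polygamma 1 (y + \<gamma>)) (at y)"
      by (auto intro!: derivative_eq_intros)
    then have "((\<lambda>t. Digamma (t + \<gamma>)) has_real_derivative ?DG y) (at y)"
      using DERIV_imp_deriv by fastforce
    then show ?thesis
      unfolding f1_def f2_def by (intro DERIV_diff DERIV_cmult V')
  qed
  define w where "w = weight_term \<alpha> \<beta> \<gamma> V \<rho>"
  have w_eq: "w k = exp (f (real k)) * \<rho> ^ k / fact k" for k
  proof -
    have "Gamma (real k + \<gamma>) = exp (ln_Gamma (real k + \<gamma>))"
      using par by (simp add: Gamma_real_pos_exp)
    moreover have "0 < V (\<alpha> * real k + \<beta>)" by (intro reg arg) simp
    ultimately show ?thesis by (simp add: w_def weight_term_def f_def exp_diff)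
  qed
  have w_pos: "0 < w k" for k unfolding w_eq using par by simp
  have Z: "w sums Z \<alpha> \<beta> \<gamma> V \<rho>"
    using assms(6) by (simp add: w_def Z_def summable_sums)
  have Z_pos: "0 < Z \<alpha> \<beta> \<gamma> V \<rho>"
    using sums_unique[OF Z] suminf_pos[OF sums_summable[OF Z] w_pos] by simp
  define p where "p k = w k / Z \<alpha> \<beta> \<gamma> V \<rho>" for k
  have prob_p: "prob {\<omega> \<in> space M. X \<omega> = k} = p k" for k
    using assms(9) by (simp add: p_def w_def)
  have p_pos: "0 < p k" for k using w_pos Z_pos by (simp add: p_def)
  have p1: "p sums 1" using sums_divide[OF Z, of "Z \<alpha> \<beta> \<gamma> V \<rho>"] Z_pos by (simp add: p_def[abs_def])
  define r where "r k = \<rho> * exp (f (real (Suc k)) - f (real k))" for k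
  have rec: "real (Suc k) * p (Suc k) = r k * p k" for k
  proof -
    have "real (Suc k) * w (Suc k) = r k * w k"
      unfolding w_eq r_def by (simp add: exp_diff del: of_nat_Suc)
    then show ?thesis by (simp add: p_def)
  qed
  note moment1 = expectation_of_nat_valued[where h = real, OF X, unfolded prob_p]
  note moment2 = expectation_of_nat_valued[where h = "\<lambda>n. (real n)\<^sup>2", OF X, unfolded prob_p]
  have mean_pos: "0 < expectation (\<lambda>\<omega>. real (X \<omega>))" if "integrable M (\<lambda>\<omega>. real (X \<omega>))"
  proof -
    have "0 < (\<Sum>k. real k * p k)"
      using moment1 that p_pos less_imp_le[OF p_pos] by (intro suminf_pos2[where i = 1]) (auto simp: sums_iff)
    then show ?thesis using moment1(2)[OF _ that] by (simp add: sums_iff)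
  qed
  have over: "overdispersed M (\<lambda>\<omega>. real (X \<omega>))"
    if int: "integrable M (\<lambda>\<omega>. real (X \<omega>))" and ge: "\<forall>y>0. ?DG y \<ge> \<alpha> * ?DV y"
      and ne: "\<exists>y>0. ?DG y \<noteq> \<alpha> * ?DV y"
  proof -
    obtain y where y: "0 < y" "f2 y \<noteq> 0" using ne by (auto simp: f2_def)
    have nonneg: "0 \<le> f2 z" if "0 < z" for z using ge that by (simp add: f2_def)
    have "mono r"
      using mono_increments_of_second_derivative(1)[OF f1 f2 nonneg y] par by (auto simp: r_def mono_def)
    moreover obtain i j where "r i \<noteq> r j"
      using mono_increments_of_second_derivative(2)[OF f1 f2 nonneg y] par by (auto simp: r_def)
    ultimately show ?thesis
      using int mean_pos[OF int] moment1(2) moment2(2)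
      by (intro overdispersed_of_second_moment variance_gt_mean_of_mono_ratio[OF p_pos p1 rec]) auto
  qed
  have under: "underdispersed M (\<lambda>\<omega>. real (X \<omega>))"
    if le: "\<forall>y>0. ?DG y \<le> \<alpha> * ?DV y" and ne: "\<exists>y>0. ?DG y \<noteq> \<alpha> * ?DV y"
  proof -
    obtain y where y: "0 < y" "- f2 y \<noteq> 0" using ne by (auto simp: f2_def)
    have nonneg: "0 \<le> - f2 z" if "0 < z" for z using le that by (simp add: f2_def)
    \<comment> \<open>The concave case is the convex one for \<open>- f\<close>.\<close>
    note incr = mono_increments_of_second_derivative[OF DERIV_minus[OF f1] DERIV_minus[OF f2] nonneg y]
    have anti: "antimono r"
      using incr(1) par by (force simp: r_def monotone_def)
    obtain i j where "- f (real (Suc i)) - - f (real i) \<noteq> - f (real (Suc j)) - - f (real j)"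
      using incr(2) by blast
    then have "f (real (Suc i)) - f (real i) \<noteq> f (real (Suc j)) - f (real j)" by linarith
    then have ne: "r i \<noteq> r j" using par by (simp add: r_def)
    have int: "integrable M (\<lambda>\<omega>. real (X \<omega>))" "integrable M (\<lambda>\<omega>. (real (X \<omega>))\<^sup>2)"
      using summable_moments_of_antimono_ratio[OF p_pos sums_summable[OF p1] rec anti] moment1(1) moment2(1)
      by auto
    then show ?thesis
      using mean_pos moment1(2) moment2(2)
      by (intro underdispersed_of_second_moment variance_lt_mean_of_antimono_ratio[OF p_pos p1 rec anti ne]) auto
  qed
  show ?thesis using over under by blast
qed

end
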